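(* Let $n,r$ be positive integers with $n\geq 3$, and consider the equation $$T_nT_{n+1}T_{n+2}\cdots T_{n+r}=m_1!\,m_2!\cdots m_k!$$ where $k\ge 1$ and $m_1\leq m_2\leq\cdots\leq m_k$ are positive integers. The only solution is $$T_3T_4=2!\cdot 2!\cdot 2!.$$ That is, if the equation holds for some such $k,m_1,\ldots,m_k$, then $n=3$, $r=1$ and, after discarding any trivial factors $1!$, the right-hand side is $2!\cdot 2!\cdot 2!$; and conversely $T_3T_4=2!\cdot 2!\cdot 2!$.
   Context: The Tribonacci numbers $\{T_n\}_{n\ge 0}$ are defined by $T_0=0$, $T_1=T_2=1$ and $T_{n+3}=T_{n+2}+T_{n+1}+T_n$ for $n\ge 0$. *)

theory Defs
  imports Main
begin

fun trib :: "nat \<Rightarrow> nat" where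
  "trib 0 = 0"
| "trib (Suc 0) = 1"
| "trib (Suc (Suc 0)) = 1"
| "trib (Suc (Suc (Suc n))) = trib (Suc (Suc n)) + trib (Suc n) + trib n"

end

theory Submission
  imports Defs "HOL-Analysis.Harmonic_Numbers" "HOL-Computational_Algebra.Primes"
begin

text \<open>
  The proof compares the size of the product \<open>P\<close> of the \<open>T\<^sub>j\<close>, \<open>n \<le> j \<le> n + r\<close>, with its
  2-adic valuation \<open>V\<close>; write \<open>v\<close> for the 2-adic valuation and \<open>N = n + r\<close>.

  A product of factorials is rich in factors 2. The valuation of \<open>m!\<close> is at least \<open>m div 2\<close>, so every
  \<open>m\<close> that occurs is at most \<open>2 V + 1\<close> (lemma \<open>le_multiplicity_2_fact\<close>); and since \<open>v (m!)\<close> is in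
  fact close to \<open>m\<close>, one has \<open>m! \<le> (m + 4) ^ v (m!)\<close> (lemma \<open>fact_le_power_multiplicity_2\<close>).
  Hence \<open>P \<le> (2 V + 5) ^ V\<close>.

  A product of Tribonacci numbers is poor in factors 2. The Tribonacci number \<open>T\<^sub>j\<close> is odd unless
  \<open>j\<close> is \<open>4 i\<close> or \<open>4 i - 1\<close>, and then its valuation is at most \<open>v i + v (i + 1) + 1\<close> or
  \<open>v i + v (i + 4) + 1\<close>. The reason is that the two-sided Tribonacci sequence vanishes at
  \<open>0\<close>, \<open>-1\<close>, \<open>-4\<close> and \<open>-17\<close>, and that near these zeros it behaves 2-adically like a linear
  function of the index along steps of length 32, while its residue modulo 16 has period 32 and
  settles the remaining indices. Valuations of consecutive integers add up to little more than their
  number, so \<open>V\<close> is at most about \<open>3 r / 2 + 4 log N\<close>, the logarithm to base 2 (lemma \<open>sum_multiplicity_trib\<close>).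

  As \<open>T\<^sub>j\<close> grows faster than \<open>(9/5) ^ j\<close>, the logarithm of \<open>P\<close> is of order \<open>(r + 1) N\<close>, whereas
  the logarithm of \<open>(2 V + 5) ^ V\<close> is only of order \<open>(r + log N) log (r + log N)\<close>. The explicit
  constants give a contradiction for \<open>N \<ge> 80\<close>.

  For \<open>N < 80\<close> the bound \<open>m \<le> 2 V + 1\<close> shows that all \<open>m\<close> are at most 265, and at most 77 if
  \<open>N < 20\<close>. Among two consecutive indices there is nearly always one whose Tribonacci number has a
  larger prime factor, which is impossible. The remaining short ranges are excluded by a prime \<open>q\<close>
  that divides none of the \<open>T\<^sub>j\<close>: then every \<open>m\<close> is less than \<open>q\<close>, although some \<open>T\<^sub>j\<close> has a prime factor above \<open>q\<close>. Only
  \<open>T\<^sub>3 T\<^sub>4 = 8\<close> survives.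
\<close>

section \<open>Tribonacci-like sequences\<close>

lemma trib_rec: "trib (n + 3) = trib (n + 2) + trib (n + 1) + trib n"
  by (simp add: numeral_3_eq_3)

text \<open>A sequence over the naturals is used also for the two-sided sequence, started at index \<open>-17\<close>.\<close>

definition tribonacci_like :: "(nat \<Rightarrow> int) \<Rightarrow> bool" where
  "tribonacci_like S \<longleftrightarrow> (\<forall>n. S (n + 3) = S (n + 2) + S (n + 1) + S n)"

text \<open>The recursion with accumulators computes a term in linearly many steps and allows arbitrary,
  in particular negative, initial values.\<close>

fun trib_iter :: "'a::comm_semiring_1 \<Rightarrow> 'a \<Rightarrow> 'a \<Rightarrow> nat \<Rightarrow> 'a" where
  "trib_iter a b c 0 = a"
| "trib_iter a b c (Suc n) = trib_iter b c (a + b + c) n"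

lemma trib_iter_of_nat:
  "trib_iter (of_nat (trib k)) (of_nat (trib (Suc k))) (of_nat (trib (Suc (Suc k)))) n
     = of_nat (trib (k + n))"
proof (induction n arbitrary: k)
  case (Suc n)
  show ?case using Suc[of "Suc k"] by (simp add: add_ac)
qed simp

lemma of_nat_trib: "of_nat (trib n) = trib_iter 0 1 1 n"
  using trib_iter_of_nat[of 0 n, symmetric] by simp

lemma trib_iter_numeral:
  "trib_iter a b c (numeral k) = trib_iter b c (a + b + c) (pred_numeral k)"
  by (simp add: numeral_eq_Suc)

lemma trib_numeral: "trib (numeral k) = trib_iter 0 1 1 (numeral k)"
  using of_nat_trib[of "numeral k", where ?'a = nat] by simp

lemmas trib_iter_eval = trib_numeral trib_iter_numeral trib_iter.simps
  pred_numeral_simps BitM.simps add_num_simps numeral_plus_numeral one_plus_numeral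
  numeral_plus_one one_add_one add_0 add_0_right

lemma tribonacci_like_trib_iter: "tribonacci_like (trib_iter a b c)"
proof -
  have "trib_iter a b c (Suc (Suc (Suc n)))
      = trib_iter a b c (Suc (Suc n)) + trib_iter a b c (Suc n) + trib_iter a b c n" for n
  proof (induction n arbitrary: a b c)
    case (Suc n)
    show ?case unfolding trib_iter.simps(2)[of a b c] by (rule Suc)
  qed (simp add: add_ac)
  thus ?thesis by (simp add: tribonacci_like_def numeral_eq_Suc)
qed

lemma tribonacci_like_trib: "tribonacci_like (\<lambda>n. int (trib n))"
  by (auto simp: tribonacci_like_def numeral_3_eq_3)

text \<open>The coefficients that express a shifted solution by three consecutive values obey the recurrence
  themselves, and they do not depend on the solution. So a congruence between these coefficients is a
  congruence for all solutions at once.\<close>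

lemma trib_addition:
  assumes "tribonacci_like S"
  shows "S (n + j + 3) = int (trib (j + 1)) * S n
           + int (trib (j + 1) + trib j) * S (n + 1) + int (trib (j + 2)) * S (n + 2)"
proof (induction j arbitrary: n)
  case 0
  show ?case using assms by (simp add: tribonacci_like_def numeral_2_eq_2)
next
  case (Suc j)
  have "S (n + 3) = S (n + 2) + S (n + 1) + S n"
    using assms by (simp add: tribonacci_like_def)
  thus ?case
    using Suc[of "n + 1"] trib_rec[of j] by (simp add: algebra_simps numeral_3_eq_3 numeral_2_eq_2)
qed

section \<open>Congruences under shifts by multiples of 32\<close>

text \<open>Difference quotients again satisfy the recurrence. A congruence known for all solutions can
  therefore be applied to the quotient, which doubles the available power of 2.\<close>

lemma tribonacci_like_quotient:
  assumes "tribonacci_like S" and "E \<noteq> 0" and W: "\<And>n. S (n + N) - S n = E * W n"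
  shows "tribonacci_like W"
  unfolding tribonacci_like_def
proof
  fix n
  have "S (n + 3) = S (n + 2) + S (n + 1) + S n" for n
    using assms(1) by (simp add: tribonacci_like_def)
  from this[of n] this[of "n + N"] W[of n] W[of "n+1"] W[of "n+2"] W[of "n+3"]
  have "E * W (n + 3) = E * (W (n + 2) + W (n + 1) + W n)" by (simp add: algebra_simps)
  thus "W (n + 3) = W (n + 2) + W (n + 1) + W n" using \<open>E \<noteq> 0\<close> by simp
qed

text \<open>The matrix of a shift by 32 is the identity modulo 16: the three coefficients from
  \<open>trib_addition\<close> are \<open>1, 0, 0\<close> modulo 16.\<close>

lemma shift_32_dvd:
  assumes "tribonacci_like S"
  shows "16 dvd S (n + 32) - S n"
proof -
  have t: "trib 29 = 15902591" "trib 30 = 29249425" "trib 31 = 53798080"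
    by (simp_all only: trib_iter_eval)
  have "S (n + 32) = int (trib 30) * S n + int (trib 30 + trib 29) * S (n + 1)
          + int (trib 31) * S (n + 2)"
    using trib_addition[OF assms, of n 29] by (simp add: add.commute)
  hence "S (n + 32) - S n = 16 * (1828089 * S n + 2822001 * S (n + 1) + 3362380 * S (n + 2))"
    unfolding t by simp
  thus ?thesis by simp
qed

text \<open>Doubling the shift nearly doubles the difference. If a shift by \<open>N\<close> is the identity modulo \<open>E\<close>, say
  \<open>1 + E W\<close>, then its square is \<open>1 + 2 E W + E\<^sup>2 W\<^sup>2\<close>, and \<open>E\<^sup>2\<close> is a multiple
  of \<open>16 E\<close>, which is the precision of the congruence.\<close>

lemma double_shift_congruence:
  assumes "tribonacci_like S"
  shows "2 ^ (k + 7) dvd S (n + 32 * 2 ^ k) - S n - 2 ^ k * (S (n + 32) - S n)"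
  using assms
proof (induction k arbitrary: n S)
  case 0
  show ?case by simp
next
  case (Suc k)
  define N :: nat where "N = 32 * 2 ^ k"
  define E :: int where "E = 2 ^ (k + 4)"
  have dvdE: "E dvd S' (n + N) - S' n" if "tribonacci_like S'" for S' n
  proof -
    have "E dvd 2 ^ (k + 7)" unfolding E_def by (simp add: le_imp_power_dvd)
    hence "E dvd S' (n + N) - S' n - 2 ^ k * (S' (n + 32) - S' n)"
      using Suc.IH[OF that, of n] unfolding N_def by (rule dvd_trans)
    moreover have "E dvd 2 ^ k * (S' (n + 32) - S' n)"
      using mult_dvd_mono[OF dvd_refl shift_32_dvd[OF that, of n], of "2 ^ k"]
      by (simp add: E_def power_add)
    ultimately show ?thesis by (metis diff_add_cancel dvd_add)
  qed
  define W where "W n = (S (n + N) - S n) div E" for n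
  have W: "S (n + N) - S n = E * W n" for n
    unfolding W_def by (rule dvd_mult_div_cancel[OF dvdE[OF Suc.prems], symmetric])
  have "tribonacci_like W"
    by (rule tribonacci_like_quotient[OF Suc.prems _ W]) (simp add: E_def)
  from dvdE[OF this, of n] obtain c where c: "W (n + N) - W n = E * c" by blast
  obtain b where b: "S (n + N) - S n - 2 ^ k * (S (n + 32) - S n) = 2 ^ (k + 7) * b"
    using Suc.IH[OF Suc.prems, of n] unfolding N_def by blast
  have "S (n + 32 * 2 ^ Suc k) - S n = (S (n + N + N) - S (n + N)) + (S (n + N) - S n)"
    by (simp add: N_def mult.commute add.assoc flip: mult_2)
  also have "\<dots> = 2 * (S (n + N) - S n) + E * (W (n + N) - W n)"
    using W[of n] W[of "n + N"] by (simp add: algebra_simps)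
  also have "S (n + N) - S n = 2 ^ k * (S (n + 32) - S n) + 2 ^ (k + 7) * b"
    using b by simp
  also have "E * (W (n + N) - W n) = 2 ^ (Suc k + 7) * (2 ^ k * c)"
    unfolding c by (simp add: E_def power_add)
  finally have "S (n + 32 * 2 ^ Suc k) - S n - 2 ^ Suc k * (S (n + 32) - S n)
      = 2 ^ (Suc k + 7) * (b + 2 ^ k * c)"
    by (simp add: algebra_simps power_add)
  thus ?case by (metis dvd_triv_left)
qed

lemma shift_32_mult_dvd:
  assumes "tribonacci_like S"
  shows "16 dvd S (n + 32 * m) - S n"
proof (induction m)
  case (Suc m)
  have "16 dvd (S (n + 32 * m + 32) - S (n + 32 * m)) + (S (n + 32 * m) - S n)"
    using shift_32_dvd[OF assms] Suc by (rule dvd_add)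
  thus ?case by (simp add: algebra_simps)
qed simp

text \<open>The difference is linear in the number of shifts, with an error that carries the full power of 2
  contained in that number: moving the base point changes the difference \<open>S (n + 32) - S n\<close> only
  by a multiple of \<open>256\<close>.\<close>

lemma shift_congruence:
  assumes "tribonacci_like S"
  shows "2 ^ (k + 7) dvd S (n + 32 * (2 ^ k * d)) - S n - 2 ^ k * int d * (S (n + 32) - S n)"
proof (induction d)
  case (Suc d)
  define W where "W n = (S (n + 32) - S n) div 16" for n
  have W: "S (n + 32) - S n = 16 * W n" for n
    unfolding W_def by (rule dvd_mult_div_cancel[OF shift_32_dvd[OF assms], symmetric])
  have "tribonacci_like W"
    by (rule tribonacci_like_quotient[OF assms _ W]) simp
  define n' where "n' = n + 32 * (2 ^ k * d)"
  obtain c where c: "W n' - W n = 16 * c"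
    using shift_32_mult_dvd[OF \<open>tribonacci_like W\<close>, of n "2 ^ k * d"] unfolding n'_def by blast
  obtain a where a: "S (n' + 32 * 2 ^ k) - S n' - 2 ^ k * (16 * W n') = 2 ^ (k + 7) * a"
    using double_shift_congruence[OF assms, of k n'] unfolding W by blast
  obtain b where b: "S n' - S n - 2 ^ k * int d * (16 * W n) = 2 ^ (k + 7) * b"
    using Suc unfolding n'_def W by blast
  have "S (n + 32 * (2 ^ k * Suc d)) = S (n' + 32 * 2 ^ k)"
    by (simp add: n'_def algebra_simps)
  hence "S (n + 32 * (2 ^ k * Suc d)) - S n - 2 ^ k * int (Suc d) * (16 * W n)
       = 2 ^ (k + 7) * a + 2 ^ (k + 7) * b + 2 ^ k * 16 * (W n' - W n)"
    using a b by (simp add: algebra_simps)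
  also have "\<dots> = 2 ^ (k + 7) * (a + b + 2 * c)"
    unfolding c by (simp add: algebra_simps power_add)
  finally show ?case unfolding W by simp
qed simp

lemma multiplicity_2_exact:
  assumes "x = 2 ^ k * y" "odd (y::int)"
  shows "multiplicity 2 x = k"
proof (rule multiplicity_eqI)
  show "2 ^ k dvd x" using assms(1) by simp
  show "\<not> 2 ^ Suc k dvd x" using assms by (simp add: mult.commute[of 2])
qed

text \<open>At a zero \<open>n\<close> of \<open>S\<close> the linear term of \<open>shift_congruence\<close> is \<open>m * S (n + 32)\<close>. It has a smaller
  valuation than the error term provided that \<open>2 ^ 7\<close> does not divide \<open>S (n + 32)\<close>.\<close>

lemma multiplicity_2_at_shifted_zero:
  assumes S: "tribonacci_like S" and zero: "S n = 0" and e: "e < 7"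
    and y: "S (n + 32) = 2 ^ e * y" "odd y" and m: "m > 0"
  shows "multiplicity 2 (S (n + 32 * m)) = multiplicity 2 m + e"
proof -
  define k where "k = multiplicity 2 m"
  have "m \<noteq> 0" "\<not> is_unit (2::nat)" using m by simp_all
  from multiplicity_decompose'[OF this]
  obtain d where d: "m = 2 ^ k * d" "odd d" unfolding k_def .
  have "2 ^ (k + 7) dvd S (n + 32 * m) - 2 ^ k * int d * (2 ^ e * y)"
    using shift_congruence[OF S, of k n d] unfolding zero y(1) d(1)[symmetric] by simp
  then obtain c where c: "S (n + 32 * m) - 2 ^ k * int d * (2 ^ e * y) = 2 ^ (k + 7) * c"
    by (rule dvdE)
  have "(2::int) ^ (k + 7) = 2 ^ (k + e) * 2 ^ (7 - e)"
    unfolding power_add[symmetric] using e by simp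
  hence "S (n + 32 * m) = 2 ^ (k + e) * (int d * y + 2 ^ (7 - e) * c)"
    using c by (simp add: algebra_simps power_add)
  moreover have "odd (int d * y + 2 ^ (7 - e) * c)"
    using d(2) y(2) e by simp
  ultimately show ?thesis
    using multiplicity_2_exact unfolding k_def by blast
qed

text \<open>The Tribonacci sequence started at index \<open>-17\<close>, where \<open>T\<close> takes the values \<open>0, 56, -47\<close>.
  The zeros of \<open>T\<close> at \<open>-17\<close>, \<open>-4\<close> and \<open>-1\<close> thereby get natural indices.\<close>

definition trib_back :: "nat \<Rightarrow> int" where
  "trib_back = trib_iter 0 56 (-47)"

lemma trib_iter_add_numeral:
  "trib_iter a b c (n + numeral k) = trib_iter b c (a + b + c) (n + pred_numeral k)"
  by (simp add: numeral_eq_Suc)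

lemma trib_back_shift: "trib_back (n + 17) = int (trib n)"
proof -
  have "trib_iter 0 56 (-47) (n + 17) = (trib_iter 0 1 1 n :: int)"
    by (simp add: trib_iter_add_numeral)
  thus ?thesis unfolding trib_back_def of_nat_trib .
qed

section \<open>The 2-adic valuation of Tribonacci numbers\<close>

lemma multiplicity_2_int: "multiplicity 2 (int n) = multiplicity 2 n"
proof (cases "n = 0")
  case False
  have "\<not> is_unit (2::nat)" by simp
  from multiplicity_decompose'[OF False this]
  obtain y where "n = 2 ^ multiplicity 2 n * y" "odd y" .
  hence "int n = 2 ^ multiplicity 2 n * int y" by (metis of_nat_mult of_nat_numeral of_nat_power)
  thus ?thesis using multiplicity_2_exact \<open>odd y\<close> even_of_nat by blast
qed simp

text \<open>The index \<open>b\<close> of \<open>trib_back\<close> is the index \<open>b - 17\<close> of the Tribonacci sequence, and \<open>c\<close> is the first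
  index after it in its class modulo 32 at which the valuation is read off.\<close>

lemma trib_shift_zero:
  assumes "trib_back b = 0" "b + 32 = c + 17" "trib c = 2 ^ e * y" "odd y" "e < 7" "m > 0"
    "b + 32 * m = n + 17"
  shows "multiplicity 2 (trib n) = multiplicity 2 m + e"
proof -
  have "trib_back (b + 32) = 2 ^ e * int y"
    unfolding assms(2) trib_back_shift assms(3) by simp
  hence "multiplicity 2 (trib_back (b + 32 * m)) = multiplicity 2 m + e"
    using multiplicity_2_at_shifted_zero[of trib_back b e "int y" m] assms
      tribonacci_like_trib_iter[of 0 56 "-47"] by (simp add: trib_back_def)
  thus ?thesis unfolding assms(7) trib_back_shift multiplicity_2_int .
qed

lemma trib_values_shifted_zeros:
  "trib 15 = 2 ^ 6 * 49" "trib 28 = 2 ^ 4 * 540379"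
  "trib 31 = 2 ^ 6 * 840595" "trib 32 = 2 ^ 4 * 6184381"
proof -
  have "trib 15 = 3136" "trib 28 = 8646064" "trib 31 = 53798080" "trib 32 = 98950096"
    by (simp_all only: trib_iter_eval)
  thus "trib 15 = 2 ^ 6 * 49" "trib 28 = 2 ^ 4 * 540379"
  "trib 31 = 2 ^ 6 * 840595" "trib 32 = 2 ^ 4 * 6184381" by simp_all
qed

text \<open>The zeros of the Tribonacci sequence at \<open>-17\<close>, \<open>-4\<close>, \<open>-1\<close> and \<open>0\<close>.\<close>

lemma trib_back_zeros:
  "trib_back 0 = 0" "trib_back 13 = 0" "trib_back 16 = 0" "trib_back 17 = 0"
  using trib_back_shift[of 0] by (simp_all add: trib_back_def trib_iter_numeral)

lemma multiplicity_trib_0: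
  assumes "m > 0" shows "multiplicity 2 (trib (32 * m)) = multiplicity 2 m + 4"
  by (rule trib_shift_zero[OF trib_back_zeros(4) _ trib_values_shifted_zeros(4)])
    (use assms in simp_all)

lemma multiplicity_trib_28:
  "multiplicity 2 (trib (32 * m + 28)) = multiplicity 2 (Suc m) + 4"
  by (rule trib_shift_zero[OF trib_back_zeros(2) _ trib_values_shifted_zeros(2)])
    (simp_all)

lemma multiplicity_trib_31:
  "multiplicity 2 (trib (32 * m + 31)) = multiplicity 2 (Suc m) + 6"
  by (rule trib_shift_zero[OF trib_back_zeros(3) _ trib_values_shifted_zeros(3)])
    (simp_all)

lemma multiplicity_trib_15:
  "multiplicity 2 (trib (32 * m + 15)) = multiplicity 2 (Suc m) + 6"
  by (rule trib_shift_zero[OF trib_back_zeros(1) _ trib_values_shifted_zeros(1)])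
    (simp_all)

lemma trib_mod_16: "trib (32 * m + n) mod 16 = trib n mod 16"
proof -
  have "16 dvd int (trib (n + 32 * m)) - int (trib n)"
    by (rule shift_32_mult_dvd[OF tribonacci_like_trib])
  hence "int (trib (n + 32 * m)) mod int 16 = int (trib n) mod int 16"
    by (simp add: mod_eq_dvd_iff)
  thus ?thesis by (simp only: add.commute flip: zmod_int of_nat_eq_iff)
qed

text \<open>Away from the zeros the valuation is at most 3, hence visible modulo 16.\<close>

lemma multiplicity_2_le_mod_16:
  fixes x :: nat
  assumes "x mod 16 = y mod 16" "\<not> 2 ^ Suc e dvd y" "e < 4"
  shows "multiplicity 2 x \<le> e"
proof -
  have "(2::nat) ^ Suc e dvd 2 ^ 4" using assms(3) by (intro le_imp_power_dvd) simp
  hence "(2::nat) ^ Suc e dvd 16" by simp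
  hence "2 ^ Suc e dvd x \<longleftrightarrow> 2 ^ Suc e dvd y"
    using assms(1) by (metis dvd_mod_iff)
  hence "\<not> 2 ^ Suc e dvd x" using assms(2) by blast
  moreover from this have "x \<noteq> 0" by (metis dvd_0_right)
  ultimately have "multiplicity 2 x < Suc e" by (intro multiplicity_lessI) simp_all
  thus ?thesis by simp
qed

lemma multiplicity_2_ge:
  fixes x :: nat
  assumes "x > 0" "2 ^ e dvd x"
  shows "e \<le> multiplicity 2 x"
  using assms by (intro multiplicity_geI) simp_all

lemma multiplicity_2_times_8:
  fixes m :: nat
  assumes "m > 0"
  shows "multiplicity 2 (8 * m) = multiplicity 2 m + 3"
  using multiplicity_times_same[of "4 * m" "2::nat"] multiplicity_times_same[of "2 * m" "2::nat"]
    multiplicity_times_same[of m "2::nat"] assms by simp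

lemma nat_mod_8_cases:
  fixes i :: nat
  obtains m where "i = 8 * m" | m where "i = 8 * m + 1" | m where "i = 8 * m + 2"
    | m where "i = 8 * m + 3" | m where "i = 8 * m + 4" | m where "i = 8 * m + 5"
    | m where "i = 8 * m + 6" | m where "i = 8 * m + 7"
proof -
  have "i = 8 * (i div 8) + i mod 8" "i mod 8 < 8" by simp_all
  moreover from this(2) have "i mod 8 = 0 \<or> i mod 8 = 1 \<or> i mod 8 = 2 \<or> i mod 8 = 3
      \<or> i mod 8 = 4 \<or> i mod 8 = 5 \<or> i mod 8 = 6 \<or> i mod 8 = 7" by linarith
  ultimately show ?thesis using that by (metis add_0_right)
qed

text \<open>The indices \<open>4 i\<close> near the zeros \<open>0\<close> and \<open>-4\<close> are those with \<open>i\<close> congruent to 0 or 7 modulo 8.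
  In the other classes \<open>i (i + 1)\<close> visibly contains the factors 2 that the residue of \<open>T\<close> modulo 16
  requires.\<close>

lemma multiplicity_trib_4_mult:
  assumes "i > 0"
  shows "multiplicity 2 (trib (4 * i)) \<le> multiplicity 2 i + multiplicity 2 (i + 1) + 1"
proof -
  have nonspecial: ?thesis
    if "4 * i = 32 * m + n" "\<not> 2 ^ Suc (a + b + 1) dvd trib n" "a + b + 1 < 4"
      "2 ^ a dvd i" "2 ^ b dvd i + 1" for m n a b
  proof -
    have "multiplicity 2 (trib (4 * i)) \<le> a + b + 1"
      unfolding that(1) using multiplicity_2_le_mod_16[OF trib_mod_16 that(2,3)] .
    moreover have "a \<le> multiplicity 2 i" using assms that(4) by (rule multiplicity_2_ge)
    moreover have "b \<le> multiplicity 2 (i + 1)" using that(5) by (intro multiplicity_2_ge) auto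
    ultimately show ?thesis by linarith
  qed
  have t: "trib 4 = 4" "trib 8 = 44" "trib 12 = 504" "trib 16 = 5768" "trib 20 = 66012"
     "trib 24 = 755476" by (simp_all only: trib_iter_eval)
  show ?thesis
  proof (cases i rule: nat_mod_8_cases)
    case (1 m)
    hence "m > 0" "4 * i = 32 * m" using assms by simp_all
    thus ?thesis using multiplicity_trib_0 multiplicity_2_times_8 1 by simp
  next
    case (2 m)
    show ?thesis by (rule nonspecial[of m 4 0 1]) (simp_all add: 2 t | presburger)+
  next
    case (3 m)
    show ?thesis by (rule nonspecial[of m 8 1 0]) (simp_all add: 3 t | presburger)+
  next
    case (4 m)
    show ?thesis by (rule nonspecial[of m 12 0 2]) (simp_all add: 4 t | presburger)+
  next
    case (5 m)
    show ?thesis by (rule nonspecial[of m 16 2 0]) (simp_all add: 5 t | presburger)+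
  next
    case (6 m)
    show ?thesis by (rule nonspecial[of m 20 0 1]) (simp_all add: 6 t | presburger)+
  next
    case (7 m)
    show ?thesis by (rule nonspecial[of m 24 1 0]) (simp_all add: 7 t | presburger)+
  next
    case (8 m)
    have "4 * i = 32 * m + 28" using 8 by simp
    moreover have "multiplicity 2 (i + 1) = multiplicity 2 (Suc m) + 3"
      using multiplicity_2_times_8[of "Suc m"] 8 by (simp add: add.commute)
    ultimately show ?thesis using multiplicity_trib_28[of m] by simp
  qed
qed

text \<open>Here the zeros are \<open>-1\<close> and \<open>-17\<close>, which \<open>4 i - 1\<close> approaches for \<open>i\<close> congruent to 0 and 4 modulo 8.\<close>

lemma multiplicity_trib_4_mult_minus_1:
  assumes "i > 0"
  shows "multiplicity 2 (trib (4 * i - 1)) \<le> multiplicity 2 i + multiplicity 2 (i + 4) + 1"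
proof -
  have nonspecial: ?thesis
    if "4 * i - 1 = 32 * m + n" "\<not> 2 ^ Suc (a + b + 1) dvd trib n" "a + b + 1 < 4"
      "2 ^ a dvd i" "2 ^ b dvd i + 4" for m n a b
  proof -
    have "multiplicity 2 (trib (4 * i - 1)) \<le> a + b + 1"
      unfolding that(1) using multiplicity_2_le_mod_16[OF trib_mod_16 that(2,3)] .
    moreover have "a \<le> multiplicity 2 i" using assms that(4) by (rule multiplicity_2_ge)
    moreover have "b \<le> multiplicity 2 (i + 4)" using that(5) by (intro multiplicity_2_ge) auto
    ultimately show ?thesis by linarith
  qed
  have t: "trib 3 = 2" "trib 7 = 24" "trib 11 = 274" "trib 19 = 35890" "trib 23 = 410744"
     "trib 27 = 4700770" by (simp_all only: trib_iter_eval)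
  show ?thesis
  proof (cases i rule: nat_mod_8_cases)
    case (1 m)
    then obtain k where k: "m = Suc k" using assms by (cases m) auto
    have "4 * i - 1 = 32 * k + 31" using 1 k by simp
    moreover have "multiplicity 2 i = multiplicity 2 (Suc k) + 3"
      unfolding 1 k by (rule multiplicity_2_times_8) simp
    moreover have "multiplicity 2 (i + 4) \<ge> 2" using 1 by (intro multiplicity_2_ge) auto
    ultimately show ?thesis using multiplicity_trib_31[of k] by simp
  next
    case (2 m)
    show ?thesis by (rule nonspecial[of m 3 0 0]) (simp_all add: 2 t | presburger)+
  next
    case (3 m)
    show ?thesis by (rule nonspecial[of m 7 1 1]) (simp_all add: 3 t | presburger)+
  next
    case (4 m)
    show ?thesis by (rule nonspecial[of m 11 0 0]) (simp_all add: 4 t | presburger)+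
  next
    case (5 m)
    have "4 * i - 1 = 32 * m + 15" using 5 by simp
    moreover have "multiplicity 2 (i + 4) = multiplicity 2 (Suc m) + 3"
      using multiplicity_2_times_8[of "Suc m"] 5 by (simp add: add.commute)
    moreover have "multiplicity 2 i \<ge> 2" using 5 by (intro multiplicity_2_ge) auto
    ultimately show ?thesis using multiplicity_trib_15[of m] by simp
  next
    case (6 m)
    show ?thesis by (rule nonspecial[of m 19 0 0]) (simp_all add: 6 t | presburger)+
  next
    case (7 m)
    show ?thesis by (rule nonspecial[of m 23 1 1]) (simp_all add: 7 t | presburger)+
  next
    case (8 m)
    show ?thesis by (rule nonspecial[of m 27 0 0]) (simp_all add: 8 t | presburger)+
  qed
qed

lemma odd_trib_iff: "odd (trib n) \<longleftrightarrow> n mod 4 = 1 \<or> n mod 4 = 2"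
proof (induction n rule: less_induct)
  case (less n)
  show ?case
  proof (cases "n < 4")
    case True
    hence "n = 0 \<or> n = 1 \<or> n = 2 \<or> n = 3" by linarith
    moreover have "trib 1 = 1" "trib 2 = 1" "trib 3 = 2"
      by (simp_all add: numeral_2_eq_2 numeral_3_eq_3)
    ultimately show ?thesis by auto
  next
    case False
    then obtain k where k: "n = k + 4" by (metis add.commute le_Suc_ex not_less)
    have "trib n = 2 * (trib (k + 2) + trib (k + 1)) + trib k"
      using trib_rec[of k] trib_rec[of "k + 1"] by (simp add: k add.commute)
    thus ?thesis using less[of k] k by simp
  qed
qed

section \<open>The 2-adic valuation of factorials\<close>

lemma multiplicity_2_double: "n > 0 \<Longrightarrow> multiplicity 2 (2 * n) = Suc (multiplicity 2 (n::nat))"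
  by (intro multiplicity_times_same) simp_all

lemma multiplicity_2_mult:
  "x > 0 \<Longrightarrow> y > 0 \<Longrightarrow> multiplicity 2 (x * y) = multiplicity 2 x + multiplicity 2 (y::nat)"
  by (intro prime_elem_multiplicity_mult_distrib) auto

lemma multiplicity_2_odd: "odd n \<Longrightarrow> multiplicity 2 (n::nat) = 0"
  by (rule not_dvd_imp_multiplicity_0)

text \<open>Halving the even members of an interval gives an interval of half the length. Each halving counts
  the even members once; the summand \<open>L\<close> pays for the rounding in the at most \<open>L\<close> halvings.\<close>

lemma sum_multiplicity_2_window:
  assumes "0 < a" "a \<le> b" "b < 2 ^ Suc L"
  shows "(\<Sum>i=a..b. multiplicity 2 i) \<le> (b - a) + L"
  using assms
proof (induction L arbitrary: a b)
  case 0
  hence "a = 1" "b = 1" by auto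
  thus ?case by simp
next
  case (Suc L)
  define a' b' where "a' = (a + 1) div 2" and "b' = b div 2"
  have evens: "{i \<in> {a..b}. even i} = (\<lambda>j. 2 * j) ` {a'..b'}"
  proof (intro set_eqI iffI)
    fix i assume "i \<in> {i \<in> {a..b}. even i}"
    then obtain j where "i = 2 * j" "a \<le> 2 * j" "2 * j \<le> b" by auto
    thus "i \<in> (\<lambda>j. 2 * j) ` {a'..b'}"
      by (intro image_eqI[of _ _ j]) (auto simp: a'_def b'_def)
  qed (auto simp: a'_def b'_def)
  have pos: "0 < a'" using Suc.prems(1) by (simp add: a'_def)
  have "(\<Sum>i=a..b. multiplicity 2 i) = (\<Sum>i\<in>{i \<in> {a..b}. even i}. multiplicity 2 i)"
    by (rule sum.mono_neutral_right) (auto simp: multiplicity_2_odd)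
  also have "\<dots> = (\<Sum>j=a'..b'. multiplicity 2 (2 * j))"
    unfolding evens by (subst sum.reindex) (auto simp: inj_on_def)
  also have "\<dots> = (\<Sum>j=a'..b'. 1 + multiplicity 2 j)"
    using pos by (intro sum.cong) (auto simp: multiplicity_2_double)
  also have "\<dots> = (b' + 1 - a') + (\<Sum>j=a'..b'. multiplicity 2 j)"
    unfolding sum.distrib by simp
  also have "\<dots> \<le> (b - a) + Suc L"
  proof (cases "a' \<le> b'")
    case True
    have "b' < 2 ^ Suc L" using Suc.prems(3) by (simp add: b'_def)
    hence "(\<Sum>j=a'..b'. multiplicity 2 j) \<le> (b' - a') + L"
      using Suc.IH[OF pos True] by blast
    moreover have "2 * (b' - a') \<le> b - a" by (simp add: a'_def b'_def)
    ultimately show ?thesis using True by linarith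
  qed simp
  finally show ?case .
qed

lemma fact_double:
  "fact (2 * a) = 2 ^ a * fact a * (\<Prod>i<a. 2 * i + 1 :: nat)"
  by (induction a) (simp_all add: algebra_simps)

lemma multiplicity_2_fact:
  "multiplicity 2 (fact (2 * a) :: nat) = a + multiplicity 2 (fact a :: nat)"
  "multiplicity 2 (fact (2 * a + 1) :: nat) = a + multiplicity 2 (fact a :: nat)"
proof -
  have odd: "odd (\<Prod>i<a. 2 * i + 1 :: nat)" by (induction a) auto
  hence pos: "0 < (\<Prod>i<a. 2 * i + 1 :: nat)" by (metis even_zero gr0I)
  show even: "multiplicity 2 (fact (2 * a) :: nat) = a + multiplicity 2 (fact a :: nat)"
    unfolding fact_double using odd pos
    by (simp add: multiplicity_2_mult multiplicity_2_odd multiplicity_same_power)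
  have "fact (2 * a + 1) = (2 * a + 1) * (fact (2 * a) :: nat)" by simp
  hence "multiplicity 2 (fact (2 * a + 1) :: nat) = multiplicity 2 (2 * a + 1) + multiplicity 2 (fact (2 * a) :: nat)"
    by (metis multiplicity_2_mult add_gr_0 fact_gt_zero zero_less_one)
  thus "multiplicity 2 (fact (2 * a + 1) :: nat) = a + multiplicity 2 (fact a :: nat)"
    unfolding even by (simp add: multiplicity_2_odd)
qed

text \<open>The arithmetic mean of the factors \<open>3, 5, \<dots>, 2 a + 1\<close> is \<open>a + 2\<close>; the inductive proof uses
  Bernoulli's inequality in place of the inequality of the means.\<close>

lemma prod_odd_le: "(\<Prod>i<a. 2 * i + 3) \<le> (a + 2) ^ (a::nat)"
proof (induction a)
  case (Suc a)
  have "real ((2 * a + 3) * (a + 2) ^ a) \<le> real ((a + 3) ^ Suc a)"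
  proof -
    define x where "x = real a + 2"
    have x: "x > 0" by (simp add: x_def)
    have "1 + real (Suc a) * (1 / x) \<le> (1 + 1 / x) ^ Suc a"
      using x by (intro Bernoulli_inequality) (simp add: field_simps)
    hence "(1 + real (Suc a) * (1 / x)) * x ^ Suc a \<le> (1 + 1 / x) ^ Suc a * x ^ Suc a"
      by (rule mult_right_mono) (use x in simp)
    also have "(1 + 1 / x) ^ Suc a * x ^ Suc a = (x + 1) ^ Suc a"
    proof -
      have "(1 + 1 / x) * x = x + 1" using x by (simp add: field_simps)
      thus ?thesis by (simp only: power_mult_distrib[symmetric])
    qed
    also have "(1 + real (Suc a) * (1 / x)) * x ^ Suc a = (x + real (Suc a)) * x ^ a"
      using x by (simp add: field_simps)
    also have "x + real (Suc a) = 2 * a + 3" by (simp add: x_def)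
    also have "x + 1 = a + 3" by (simp add: x_def)
    finally show ?thesis by (simp add: x_def add.commute)
  qed
  hence "(2 * a + 3) * (a + 2) ^ a \<le> (a + 3) ^ Suc a"
    by (simp only: of_nat_le_iff)
  moreover have "(\<Prod>i<Suc a. 2 * i + 3) \<le> (2 * a + 3) * (a + 2) ^ a"
    using Suc by (simp add: mult.commute mult_le_mono)
  ultimately show ?case by (simp add: numeral_eq_Suc)
qed simp

lemma fact_odd_le: "fact (2 * a + 1) \<le> (2 * a + 4) ^ a * (fact a :: nat)"
proof -
  have "(\<Prod>i<Suc a. 2 * i + 1 :: nat) = (\<Prod>i<a. 2 * i + 3)"
    by (subst prod.lessThan_Suc_shift) (simp add: algebra_simps numeral_3_eq_3)
  hence "fact (2 * a + 1) = 2 ^ a * fact a * (\<Prod>i<a. 2 * i + 3 :: nat)"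
    using fact_double[of a] by (simp add: algebra_simps)
  also have "\<dots> \<le> 2 ^ a * fact a * (a + 2) ^ a"
    using prod_odd_le by (intro mult_left_mono) auto
  also have "\<dots> = (2 * a + 4) ^ a * fact a"
  proof -
    have "2 * a + 4 = 2 * (a + 2)" by simp
    thus ?thesis by (simp only: power_mult_distrib mult_ac)
  qed
  finally show ?thesis .
qed

lemma multiplicity_2_fact_div_2:
  "multiplicity 2 (fact m :: nat) = m div 2 + multiplicity 2 (fact (m div 2) :: nat)"
proof -
  have "m = 2 * (m div 2) \<or> m = 2 * (m div 2) + 1" by presburger
  thus ?thesis using multiplicity_2_fact[of "m div 2"] by metis
qed

lemma le_multiplicity_2_fact: "m \<le> 2 * multiplicity 2 (fact m :: nat) + 1"
proof -
  have "m \<le> 2 * (m div 2) + 1" by presburger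
  also have "\<dots> \<le> 2 * multiplicity 2 (fact m :: nat) + 1"
    unfolding multiplicity_2_fact_div_2[of m] by simp
  finally show ?thesis .
qed

text \<open>By induction along \<open>m \<mapsto> m div 2 = a\<close>: passing from \<open>a!\<close> to \<open>m!\<close> gains \<open>a\<close> factors 2 and costs at
  most a factor \<open>(2 a + 4) ^ a\<close>, where \<open>2 a + 4 \<le> m + 4 \<le> K\<close>.\<close>

lemma fact_le_power_multiplicity_2:
  assumes "m + 4 \<le> K"
  shows "fact m \<le> K ^ multiplicity 2 (fact m :: nat)"
  using assms
proof (induction m rule: less_induct)
  case (less m)
  show ?case
  proof (cases "m \<le> 1")
    case True
    hence "fact m = (1 :: nat)" by (auto simp: le_Suc_eq)
    thus ?thesis by simp
  next
    case False
    define a where "a = m div 2"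
    have a: "a < m" "m \<le> 2 * a + 1" "2 * a + 4 \<le> K"
      using False less.prems unfolding a_def by auto
    have "fact m \<le> (fact (2 * a + 1) :: nat)" using a(2) by (rule fact_mono)
    also have "\<dots> \<le> (2 * a + 4) ^ a * fact a" by (rule fact_odd_le)
    also have "\<dots> \<le> K ^ a * K ^ multiplicity 2 (fact a :: nat)"
      using less.IH[OF a(1)] a less.prems by (intro mult_mono power_mono) auto
    also have "\<dots> = K ^ multiplicity 2 (fact m :: nat)"
      unfolding multiplicity_2_fact_div_2[of m] a_def by (simp add: power_add)
    finally show ?thesis .
  qed
qed

lemma multiplicity_2_prod_list_fact:
  "multiplicity 2 (\<Prod>m\<leftarrow>ms. fact m :: nat) = (\<Sum>m\<leftarrow>ms. multiplicity 2 (fact m :: nat))"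
proof (induction ms)
  case (Cons m ms)
  have "(\<Prod>m\<leftarrow>ms. fact m :: nat) > 0" by (induction ms) auto
  thus ?case using Cons by (simp add: multiplicity_2_mult)
qed simp

text \<open>Each \<open>m\<close> has \<open>v (m!) \<le> V\<close>. Taking the base \<open>2 V + 5\<close>, which is at least \<open>m + 4\<close> for each of them, the
  bounds for the single factorials multiply.\<close>

lemma prod_fact_bounds:
  fixes ms :: "nat list"
  defines "V \<equiv> multiplicity 2 (\<Prod>m\<leftarrow>ms. fact m :: nat)"
  shows "\<forall>m\<in>set ms. m \<le> 2 * V + 1" and "(\<Prod>m\<leftarrow>ms. fact m) \<le> (2 * V + 5) ^ V"
proof -
  show le: "\<forall>m\<in>set ms. m \<le> 2 * V + 1"
  proof
    fix m assume "m \<in> set ms"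
    hence "multiplicity 2 (fact m :: nat) \<le> V"
      unfolding V_def multiplicity_2_prod_list_fact by (intro member_le_sum_list) auto
    thus "m \<le> 2 * V + 1" using le_multiplicity_2_fact[of m] by linarith
  qed
  have "(\<Prod>m\<leftarrow>ms. fact m) \<le> K ^ (\<Sum>m\<leftarrow>ms. multiplicity 2 (fact m :: nat))"
    if "\<forall>m\<in>set ms. m + 4 \<le> K" for K
    using that
  proof (induction ms)
    case (Cons m ms)
    thus ?case using fact_le_power_multiplicity_2[of m K] by (simp add: power_add mult_le_mono)
  qed simp
  from this[of "2 * V + 5"] show "(\<Prod>m\<leftarrow>ms. fact m) \<le> (2 * V + 5) ^ V"
    using le unfolding V_def multiplicity_2_prod_list_fact by auto
qed

section \<open>The 2-adic valuation of a product of consecutive Tribonacci numbers\<close>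

text \<open>Applied with \<open>s = 1\<close> for the indices \<open>4 i\<close> and \<open>s = 4\<close> for the indices \<open>4 i - 1\<close>. An interval of
  \<open>r + 1\<close> indices leaves \<open>4 (b - a) \<le> r\<close>.\<close>

lemma window_bound:
  assumes "0 < a" "4 * b \<le> 4 * a + r" "b + s < 2 ^ Suc L"
  shows "4 * (\<Sum>i=a..b. multiplicity 2 i + multiplicity 2 (i + s) + 1) \<le> 3 * r + 8 * L + 4"
proof (cases "a \<le> b")
  case True
  have "(\<Sum>i=a..b. multiplicity 2 (i + s)) = (\<Sum>i=a+s..b+s. multiplicity 2 i)"
    by (rule sum.shift_bounds_cl_nat_ivl[symmetric])
  also have "\<dots> \<le> b - a + L"
    using sum_multiplicity_2_window[of "a + s" "b + s" L] assms True by simp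
  finally have "(\<Sum>i=a..b. multiplicity 2 (i + s)) \<le> b - a + L" .
  moreover have "(\<Sum>i=a..b. multiplicity 2 i) \<le> b - a + L"
    using sum_multiplicity_2_window[of a b L] assms True by simp
  ultimately have "(\<Sum>i=a..b. multiplicity 2 i + multiplicity 2 (i + s) + 1) \<le> 3 * (b - a) + 2 * L + 1"
    unfolding sum.distrib using True by simp
  thus ?thesis using assms(2) by linarith
qed simp

text \<open>The hypothesis on \<open>L\<close> makes \<open>2 ^ (L + 1)\<close> exceed the largest argument \<open>i + 4 \<le> (n + r + 17) / 4\<close>
  whose valuation enters.\<close>

lemma sum_multiplicity_trib:
  assumes "0 < n" "n + r + 17 < 2 ^ (L + 3)"
  shows "2 * (\<Sum>j=n..n+r. multiplicity 2 (trib j)) \<le> 3 * r + 8 * L + 4"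
proof -
  define A where "A = (\<lambda>i. 4 * i) ` {(n + 3) div 4..(n + r) div 4}"
  define B where "B = (\<lambda>i. 4 * i - 1) ` {(n + 4) div 4..(n + r + 1) div 4}"
  have A: "j mod 4 = 0 \<and> j \<in> {n..n+r}" if j: "j \<in> A" for j
  proof -
    obtain i where "j = 4 * i" "(n + 3) div 4 \<le> i" "i \<le> (n + r) div 4"
      using j unfolding A_def by auto
    moreover from this have "n \<le> 4 * i" "4 * i \<le> n + r" by linarith+
    ultimately show ?thesis by simp
  qed
  have B: "j mod 4 = 3 \<and> j \<in> {n..n+r}" if j: "j \<in> B" for j
  proof -
    obtain i where i: "j = 4 * i - 1" "(n + 4) div 4 \<le> i" "i \<le> (n + r + 1) div 4"
      using j unfolding B_def by auto
    hence "n + 1 \<le> 4 * i" "4 * i \<le> n + r + 1" by linarith+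
    moreover from this obtain k where "i = Suc k" by (cases i) auto
    ultimately show ?thesis using i(1) by simp
  qed
  have sub: "A \<union> B \<subseteq> {n..n+r}" using A B by blast
  have rest: "multiplicity 2 (trib j) = 0" if "j \<in> {n..n+r} - (A \<union> B)" for j
  proof -
    have "j mod 4 \<noteq> 0"
    proof
      assume "j mod 4 = 0"
      then obtain i where i: "j = 4 * i" by (metis mod_0_imp_dvd dvdE)
      hence "n \<le> 4 * i" "4 * i \<le> n + r" using that by auto
      hence "(n + 3) div 4 \<le> i" "i \<le> (n + r) div 4" by linarith+
      hence "i \<in> {(n + 3) div 4..(n + r) div 4}" by simp
      hence "j \<in> A" unfolding A_def i by (rule imageI)
      thus False using that by simp
    qed
    moreover have "j mod 4 \<noteq> 3"
    proof
      assume "j mod 4 = 3"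
      then obtain i where i: "j = 4 * i + 3" by (metis mult_div_mod_eq)
      hence "n \<le> 4 * i + 3" "4 * i + 3 \<le> n + r" using that by auto
      hence "(n + 4) div 4 \<le> Suc i" "Suc i \<le> (n + r + 1) div 4" by linarith+
      hence "Suc i \<in> {(n + 4) div 4..(n + r + 1) div 4}" by simp
      hence "4 * Suc i - 1 \<in> B" unfolding B_def by (rule imageI)
      moreover have "4 * Suc i - 1 = j" using i by simp
      ultimately show False using that by simp
    qed
    moreover have "j mod 4 < 4" by simp
    ultimately have "j mod 4 = 1 \<or> j mod 4 = 2" by linarith
    thus ?thesis using odd_trib_iff by (simp add: multiplicity_2_odd)
  qed
  have "4 * (\<Sum>j\<in>A. multiplicity 2 (trib j))
      = 4 * (\<Sum>i=(n + 3) div 4..(n + r) div 4. multiplicity 2 (trib (4 * i)))"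
    unfolding A_def by (subst sum.reindex) (auto simp: inj_on_def)
  also have "\<dots> \<le> 4 * (\<Sum>i=(n + 3) div 4..(n + r) div 4. multiplicity 2 i + multiplicity 2 (i + 1) + 1)"
    using assms(1) by (intro mult_left_mono sum_mono multiplicity_trib_4_mult) auto
  also have "\<dots> \<le> 3 * r + 8 * L + 4"
    using assms by (intro window_bound) (auto simp: power_add)
  finally have sumA: "4 * (\<Sum>j\<in>A. multiplicity 2 (trib j)) \<le> 3 * r + 8 * L + 4" .
  have "4 * (\<Sum>j\<in>B. multiplicity 2 (trib j))
      = 4 * (\<Sum>i=(n + 4) div 4..(n + r + 1) div 4. multiplicity 2 (trib (4 * i - 1)))"
    unfolding B_def by (subst sum.reindex) (auto simp: inj_on_def)
  also have "\<dots> \<le> 4 * (\<Sum>i=(n + 4) div 4..(n + r + 1) div 4. multiplicity 2 i + multiplicity 2 (i + 4) + 1)"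
    using assms(1) by (intro mult_left_mono sum_mono multiplicity_trib_4_mult_minus_1) auto
  also have "\<dots> \<le> 3 * r + 8 * L + 4"
    using assms by (intro window_bound) (auto simp: power_add)
  finally have sumB: "4 * (\<Sum>j\<in>B. multiplicity 2 (trib j)) \<le> 3 * r + 8 * L + 4" .
  have "(\<Sum>j=n..n+r. multiplicity 2 (trib j)) = (\<Sum>j\<in>A \<union> B. multiplicity 2 (trib j))"
    using sub rest by (intro sum.mono_neutral_right) auto
  also have "\<dots> = (\<Sum>j\<in>A. multiplicity 2 (trib j)) + (\<Sum>j\<in>B. multiplicity 2 (trib j))"
  proof (rule sum.union_disjoint)
    show "A \<inter> B = {}" using A B by fastforce
  qed (simp_all add: A_def B_def)
  finally show ?thesis using sumA sumB by linarith
qed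

lemma trib_pos: "n > 0 \<Longrightarrow> trib n > 0"
  by (induction n rule: trib.induct) auto

lemma prod_trib_pos: "n > 0 \<Longrightarrow> (\<Prod>j=n..n+r. trib j) > 0"
  by (intro prod_pos) (auto intro: trib_pos)

lemma multiplicity_2_prod_trib:
  assumes "n > 0"
  shows "multiplicity 2 (\<Prod>j=n..n+r. trib j) = (\<Sum>j=n..n+r. multiplicity 2 (trib j))"
proof (induction r)
  case (Suc r)
  have "multiplicity 2 ((\<Prod>j=n..n+r. trib j) * trib (n + Suc r))
      = multiplicity 2 (\<Prod>j=n..n+r. trib j) + multiplicity 2 (trib (n + Suc r))"
    using prod_trib_pos[OF assms] by (intro multiplicity_2_mult trib_pos) simp_all
  thus ?case using Suc by simp
qed simp

section \<open>Growth, and the exclusion of large indices\<close>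

text \<open>The base \<open>9/5\<close> lies below the Tribonacci constant because \<open>(9/5)\<^sup>3 \<le> (9/5)\<^sup>2 + 9/5 + 1\<close>.\<close>

lemma trib_ge_power: "(9 / 5) ^ Suc n \<le> (9 / 5)\<^sup>2 * real (trib (Suc n))"
proof (induction n rule: trib.induct)
  case (4 n)
  have "(9 / 5) ^ Suc (Suc (Suc (Suc n))) = (9 / 5) ^ 3 * (9 / 5 :: real) ^ Suc n"
    by (simp add: power3_eq_cube)
  also have "\<dots> \<le> ((9 / 5)\<^sup>2 + 9 / 5 + 1) * (9 / 5 :: real) ^ Suc n"
    by (intro mult_right_mono) (simp_all add: power3_eq_cube power2_eq_square)
  also have "\<dots> = (9 / 5) ^ Suc (Suc (Suc n)) + (9 / 5) ^ Suc (Suc n) + (9 / 5 :: real) ^ Suc n"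
    by (simp add: distrib_right power2_eq_square)
  also have "\<dots> \<le> (9 / 5)\<^sup>2 * real (trib (Suc (Suc (Suc n))))
      + (9 / 5)\<^sup>2 * real (trib (Suc (Suc n))) + (9 / 5)\<^sup>2 * real (trib (Suc n))"
    using 4 by (intro add_mono)
  also have "\<dots> = (9 / 5)\<^sup>2 * real (trib (Suc (Suc (Suc (Suc n)))))"
    unfolding trib.simps(4)[of "Suc n"] by (simp only: of_nat_add distrib_left)
  finally show ?case .
qed (simp_all add: power2_eq_square)

text \<open>The constant \<open>5/6\<close> comes from \<open>2 ^ 5 \<le> (9/5) ^ 6\<close>.\<close>

lemma log_trib_ge:
  assumes "j > 0"
  shows "5 / 6 * (real j - 2) \<le> log 2 (trib j)"
proof -
  obtain n where n: "j = Suc n" using assms by (cases j) auto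
  have "log 2 (2 ^ 5) = (5::real)" by (simp only: log_pow_cancel)
  moreover have "log 2 (2 ^ 5) \<le> log 2 ((9 / 5 :: real) ^ 6)"
    by (subst log_le_cancel_iff) (simp_all add: eval_nat_numeral)
  moreover have "log 2 ((9 / 5 :: real) ^ 6) = 6 * log 2 (9 / 5)" by (simp add: log_nat_power)
  ultimately have lg: "5 / 6 \<le> log 2 (9 / 5 :: real)" by linarith
  have "real j * log 2 (9 / 5) = log 2 ((9 / 5) ^ j)" by (simp add: log_nat_power)
  also have "\<dots> \<le> log 2 ((9 / 5)\<^sup>2 * real (trib j))"
    using trib_ge_power[of n] trib_pos[OF assms] unfolding n by (subst log_le_cancel_iff) auto
  also have "\<dots> = 2 * log 2 (9 / 5) + log 2 (trib j)"
    using trib_pos[OF assms] by (simp add: log_mult log_nat_power)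
  finally have *: "(real j - 2) * log 2 (9 / 5) \<le> log 2 (trib j)" by (simp add: algebra_simps)
  show ?thesis
  proof (cases "j \<ge> 2")
    case True
    thus ?thesis using * mult_left_mono[OF lg, of "real j - 2"] by (simp add: mult.commute)
  next
    case False
    hence "j = Suc 0" using assms by simp
    thus ?thesis by simp
  qed
qed

lemma log_prod_trib_ge:
  assumes "n > 0"
  shows "5 / 12 * (real r + 1) * (2 * real n + real r - 4) \<le> log 2 (\<Prod>j=n..n+r. trib j)"
proof (induction r)
  case 0
  show ?case using log_trib_ge[OF assms] by (simp add: algebra_simps)
next
  case (Suc r)
  have pos: "(\<Prod>j=n..n+r. trib j) > 0" using assms by (intro prod_pos) (auto intro: trib_pos)
  have "log 2 (\<Prod>j=n..n+Suc r. trib j) = log 2 (\<Prod>j=n..n+r. trib j) + log 2 (trib (n + Suc r))"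
    using pos trib_pos[of "n + Suc r"] by (simp add: log_mult)
  thus ?case using Suc log_trib_ge[of "n + Suc r"] by (simp add: algebra_simps)
qed

text \<open>A line through \<open>(32, 5)\<close> that is slightly steeper than the tangent there, whose slope is
  \<open>1 / (32 ln 2)\<close>.\<close>

lemma log_2_le_tangent:
  assumes "y \<ge> 32"
  shows "log 2 y \<le> 5 + (y - 32) / 21"
proof -
  have "ln (y / 32) \<le> y / 32 - 1" using assms by (intro ln_le_minus_one) simp
  also have "\<dots> \<le> (y - 32) / 21 * ln 2"
  proof -
    have "(y - 32) / 21 * (2 / 3) \<le> (y - 32) / 21 * ln 2"
      using assms ln2_ge_two_thirds by (intro mult_left_mono) auto
    moreover have "y / 32 - 1 \<le> (y - 32) / 21 * (2 / 3)" using assms by simp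
    ultimately show ?thesis by linarith
  qed
  finally have "log 2 (y / 32) \<le> (y - 32) / 21" by (simp add: log_def divide_le_eq)
  moreover have "log 2 y = log 2 (y / 32) + log 2 (2 ^ 5)"
    using assms by (simp add: log_divide)
  moreover have "log 2 (2 ^ 5) = (5 :: real)" by (simp only: log_pow_cancel)
  ultimately show ?thesis by linarith
qed

text \<open>The number \<open>x\<close> is the bound for the valuation, \<open>5 + (2 x - 27) / 21\<close> the one for \<open>log 2 (2 x + 5)\<close>, and
  \<open>L\<close> is about \<open>log 2 (N / 4)\<close>, of which only \<open>4 L\<^sup>2 \<le> N\<close> matters. The left-hand side is then at
  most a quadratic polynomial in \<open>r\<close> and \<open>N\<close> with leading terms well below those of the right-hand
  side, and for \<open>N \<ge> 80\<close> this outweighs the linear terms.\<close>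

lemma quadratic_estimate:
  fixes N r L :: real
  assumes N: "N \<ge> 80" and r: "1 \<le> r" "r \<le> N - 3" and L: "4 * L\<^sup>2 \<le> N"
  defines "x \<equiv> (3 * r + 8 * L + 4) / 2"
  shows "x * (5 + (2 * x - 27) / 21) < 5 / 12 * (r + 1) * (2 * N - r - 4)"
proof -
  \<comment> \<open>From \<open>(L - 5)\<^sup>2 \<ge> 0\<close>; for \<open>N\<close> near 100 the bound for \<open>L\<close> is near 5.\<close>
  have L1: "L \<le> N / 40 + 5 / 2"
    using L zero_le_power2[of "L - 5"] by (simp add: power2_eq_square algebra_simps)
  have x: "2 * x = 3 * r + 8 * L + 4" by (simp add: x_def)
  have "42 * (x * (5 + (2 * x - 27) / 21)) = (2 * x)\<^sup>2 + 78 * (2 * x)"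
    by (simp add: power2_eq_square field_simps)
  also have "\<dots> = 9 * r\<^sup>2 + 48 * r * L + 64 * L\<^sup>2 + 258 * r + 688 * L + 328"
    unfolding x by (simp add: power2_eq_square algebra_simps)
  also have "\<dots> \<le> 9 * r\<^sup>2 + 48 * r * (N / 40 + 5 / 2) + 16 * N + 258 * r + 688 * (N / 40 + 5 / 2) + 328"
    using L L1 r by (intro add_mono mult_left_mono) auto
  also have "\<dots> = 9 * r\<^sup>2 + 6 / 5 * (r * N) + 378 * r + 166 / 5 * N + 2048"
    by (simp add: algebra_simps)
  also have "\<dots> < 35 * (r * N) - 35 / 2 * r\<^sup>2 - 175 / 2 * r + 35 * N - 70"
  proof -
    \<comment> \<open>From \<open>(r - 1) (N - 3 - r) \<ge> 0\<close>, which is sharp at both ends of the range of \<open>r\<close>.\<close>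
    have "r\<^sup>2 + 2 * r + N - 3 \<le> r * N"
      using mult_nonneg_nonneg[of "r - 1" "N - 3 - r"] r
      by (simp add: power2_eq_square algebra_simps)
    moreover have "80 * r \<le> r * N" using mult_left_mono[OF N, of r] r by (simp add: mult.commute)
    ultimately show ?thesis using N r by linarith
  qed
  also have "\<dots> = 42 * (5 / 12 * (r + 1) * (2 * N - r - 4))"
    by (simp add: power2_eq_square algebra_simps)
  finally show ?thesis by linarith
qed

text \<open>The integer \<open>L\<close> is chosen as small as \<open>sum_multiplicity_trib\<close> permits; then \<open>2 ^ (L + 2) \<le> N + 17\<close>,
  which for \<open>N \<ge> 80\<close> yields \<open>L \<ge> 4\<close> and \<open>4 L\<^sup>2 \<le> N\<close>. The former puts \<open>2 x + 5\<close> into the range of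
  \<open>log_2_le_tangent\<close>, the latter is the hypothesis of \<open>quadratic_estimate\<close>.\<close>

lemma large_index_impossible:
  assumes n: "n \<ge> 3" and r: "r \<ge> 1" and large: "n + r \<ge> 80"
    and eq: "(\<Prod>j=n..n+r. trib j) = (\<Prod>m\<leftarrow>ms. fact m)"
  shows False
proof -
  define N where "N = n + r"
  define P where "P = (\<Prod>j=n..n+r. trib j)"
  define V where "V = multiplicity 2 P"
  have P: "P > 0" unfolding P_def using n by (intro prod_trib_pos) simp
  obtain l where l: "2 ^ l \<le> N + 17" "N + 17 < 2 ^ (l + 1)"
    using ex_power_ivl1[of 2 "N + 17"] by auto
  have "l \<ge> 6"
  proof (rule ccontr)
    assume "\<not> l \<ge> 6"
    hence "(2::nat) ^ (l + 1) \<le> 2 ^ 6" by (intro power_increasing) auto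
    thus False using l(2) large by (simp add: N_def)
  qed
  hence "l = (l - 2) + 2" "l - 2 \<ge> 4" by simp_all
  then obtain L where L: "l = L + 2" "L \<ge> 4" by blast
  have "4 * L\<^sup>2 \<le> N"
  proof (cases "L = 4")
    case True
    thus ?thesis using large by (simp add: N_def)
  next
    case False
    hence "L \<ge> 5" using L(2) by simp
    hence "4 * L\<^sup>2 + 17 \<le> 2 ^ (L + 2)"
    proof (induction L rule: dec_induct)
      case (step k)
      have "4 * (Suc k)\<^sup>2 + 17 = 4 * k\<^sup>2 + 17 + (8 * k + 4)" by (simp add: power2_eq_square)
      moreover have "8 * k + 4 \<le> 4 * k\<^sup>2 + 17"
        using mult_le_mono1[OF step(1), of k] unfolding power2_eq_square by linarith
      ultimately show ?case using step.IH by simp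
    qed simp
    thus ?thesis using l(1) L(1) by simp
  qed
  hence L2: "4 * (real L)\<^sup>2 \<le> real N" by (metis of_nat_le_iff of_nat_mult of_nat_numeral of_nat_power)
  have V: "2 * V \<le> 3 * r + 8 * L + 4"
  proof -
    have "L + 2 + 1 = L + 3" by simp
    hence "n + r + 17 < 2 ^ (L + 3)" using l(2) unfolding L(1) N_def by metis
    moreover have "n > 0" using n by simp
    ultimately show ?thesis
      unfolding V_def P_def using sum_multiplicity_trib multiplicity_2_prod_trib by metis
  qed
  define x where "x = (3 * real r + 8 * real L + 4) / 2"
  have Vx: "real V \<le> x" using of_nat_mono[OF V, where 'a = real] unfolding x_def by simp
  have x: "2 * x + 5 \<ge> 32" using L(2) r unfolding x_def by simp
  have "P \<le> (2 * V + 5) ^ V"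
    using prod_fact_bounds(2)[of ms] unfolding V_def P_def eq .
  hence "real P \<le> (2 * real V + 5) ^ V"
    using of_nat_mono[where 'a = real] by fastforce
  hence "log 2 P \<le> log 2 ((2 * real V + 5) ^ V)"
    using P by (subst log_le_cancel_iff) auto
  also have "\<dots> = real V * log 2 (2 * real V + 5)" by (subst log_nat_power) simp_all
  also have "\<dots> \<le> x * log 2 (2 * x + 5)"
    using Vx by (intro mult_mono) (auto simp: zero_le_log_cancel_iff)
  also have "\<dots> \<le> x * (5 + (2 * x - 27) / 21)"
    using log_2_le_tangent[OF x] Vx by (intro mult_left_mono) auto
  also have "\<dots> < 5 / 12 * (real r + 1) * (2 * real N - real r - 4)"
    unfolding x_def using L2 large r n by (intro quadratic_estimate) (auto simp: N_def)
  also have "\<dots> = 5 / 12 * (real r + 1) * (2 * real n + real r - 4)"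
    by (simp add: N_def)
  also have "\<dots> \<le> log 2 P" unfolding P_def using n by (intro log_prod_trib_ge) simp
  finally show False by simp
qed

section \<open>Small indices\<close>

text \<open>The usual notion of an \<open>M\<close>-rough number, except that 1 is excluded, so that a rough divisor has a
  prime factor.\<close>

definition rough :: "nat \<Rightarrow> nat \<Rightarrow> bool" where
  "rough M d \<longleftrightarrow> d > 1 \<and> (\<forall>p. prime p \<longrightarrow> p dvd d \<longrightarrow> M < p)"

definition small_primes :: "nat list" where
  "small_primes =
  [2, 3, 5, 7, 11, 13, 17, 19, 23, 29, 31, 37, 41, 43, 47, 53,
   59, 61, 67, 71, 73, 79, 83, 89, 97, 101, 103, 107, 109, 113, 127, 131,
   137, 139, 149, 151, 157, 163, 167, 173, 179, 181, 191, 193, 197, 199, 211, 223,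
   227, 229, 233, 239, 241, 251, 257, 263]"

text \<open>A composite number below \<open>266 < 17\<^sup>2\<close> has a prime factor among \<open>2, 3, 5, 7, 11, 13\<close>.\<close>

lemma prime_in_small_primes:
  assumes "prime p" "p < 266"
  shows "p \<in> set small_primes"
proof -
  have "list_all (\<lambda>k. k \<in> set small_primes \<or> list_ex (\<lambda>q. q dvd k \<and> q \<noteq> k) [2, 3, 5, 7, 11, 13])
          [2..<266]"
    unfolding small_primes_def by simp
  moreover have "p \<in> set [2..<266]"
    unfolding set_upt atLeastLessThan_iff using assms(2) prime_ge_2_nat[OF assms(1)] by blast
  ultimately consider "p \<in> set small_primes" | q where "q \<in> set [2, 3, 5, 7, 11, 13]" "q dvd p" "q \<noteq> p"
    by (auto simp only: list_all_iff list_ex_iff)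
  thus ?thesis
  proof cases
    case (2 q)
    hence "q = 1" using assms(1) by (meson prime_nat_iff)
    thus ?thesis using 2(1) by simp
  qed
qed

lemma roughI:
  assumes "d > 1" "M < 266" "list_all (\<lambda>p. p \<le> M \<longrightarrow> \<not> p dvd d) small_primes"
  shows "rough M d"
  unfolding rough_def
proof (intro conjI allI impI)
  fix p assume p: "prime p" "p dvd d"
  show "M < p"
  proof (rule ccontr)
    assume "\<not> M < p"
    hence "p \<in> set small_primes" "p \<le> M" using assms(2) p(1) prime_in_small_primes by auto
    thus False using assms(3) p(2) by (auto simp: list_all_iff)
  qed
qed (fact assms(1))

text \<open>Pairs of an index \<open>j\<close> and a divisor of \<open>T\<^sub>j\<close> that is free of primes up to 265. The indices meet every
  pair of neighbours from 20 to 79 except \<open>34, 35\<close>: \<open>T\<^sub>3\<^sub>4\<close> and \<open>T\<^sub>3\<^sub>5\<close> have only prime factors below 265.\<close>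

definition rough_divisors :: "(nat \<times> nat) list" where
  "rough_divisors =
  [(20, 5501), (22, 919), (23, 51343), (25, 853), (27, 470077),
   (29, 313), (30, 307), (32, 883483), (33, 11113), (36, 317),
   (38, 3539), (40, 9133), (42, 1877), (44, 71584631), (46, 647),
   (48, 1213), (50, 333701), (52, 31328771), (54, 647), (56, 479),
   (58, 1279), (59, 70229), (61, 277), (63, 532949), (65, 29905582707647),
   (67, 2011), (69, 136956013), (70, 857), (72, 36010153), (74, 1619),
   (76, 44789), (78, 4673)]"

text \<open>The same for intervals below 20, where primes above 77 suffice. The pair \<open>14, 15\<close> is missed, because
  31 is the largest prime factor of \<open>T\<^sub>1\<^sub>4 T\<^sub>1\<^sub>5\<close>.\<close>

definition rough_divisors_small :: "(nat \<times> nat) list" where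
  "rough_divisors_small =
  [(10, 149), (11, 137), (13, 103), (16, 103), (17, 103), (18, 79), (19, 97)]"

lemma rough_divisors_dvd: "\<forall>(j, d) \<in> set rough_divisors. d dvd trib j"
  unfolding rough_divisors_def by (simp only: list.set ball_simps split trib_iter_eval) simp

lemma rough_divisors_rough: "list_all (\<lambda>(j, d). rough 265 d) rough_divisors"
proof -
  have "list_all (\<lambda>(j, d). d > 1 \<and> list_all (\<lambda>p. p \<le> 265 \<longrightarrow> \<not> p dvd d) small_primes) rough_divisors"
    unfolding rough_divisors_def small_primes_def by simp
  thus ?thesis by (auto simp: list_all_iff intro!: roughI)
qed

lemma rough_divisors_cover:
  "\<forall>n\<in>set [20..<79]. n = 34 \<or> n \<in> fst ` set rough_divisors \<or> Suc n \<in> fst ` set rough_divisors"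
  unfolding rough_divisors_def by simp

lemma rough_divisors_small_cover:
  "\<forall>n\<in>set [9..<19]. n = 14 \<or> n \<in> fst ` set rough_divisors_small \<or> Suc n \<in> fst ` set rough_divisors_small"
  unfolding rough_divisors_small_def by simp

lemma rough_divisors_small_dvd: "\<forall>(j, d) \<in> set rough_divisors_small. d dvd trib j"
  unfolding rough_divisors_small_def by (simp only: list.set ball_simps split trib_iter_eval) simp

lemma rough_divisors_small_rough: "list_all (\<lambda>(j, d). rough 77 d) rough_divisors_small"
proof -
  have "list_all (\<lambda>(j, d). d > 1 \<and> list_all (\<lambda>p. p \<le> 77 \<longrightarrow> \<not> p dvd d) small_primes) rough_divisors_small"
    unfolding rough_divisors_small_def small_primes_def by simp
  thus ?thesis by (auto simp: list_all_iff intro!: roughI)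
qed

lemma trib_evals:
  "trib 3 = 2" "trib 4 = 4" "trib 5 = 7" "trib 6 = 13" "trib 7 = 24" "trib 8 = 44" "trib 9 = 81"
  "trib 14 = 1705" "trib 15 = 3136" "trib 34 = 334745777" "trib 35 = 615693474"
  by (simp_all only: trib_iter_eval)

lemma prime_dvd_prod_factD:
  assumes "prime p" "p dvd (\<Prod>m\<leftarrow>ms. fact m :: nat)"
  shows "\<exists>m\<in>set ms. p \<le> m"
  using assms(2)
proof (induction ms)
  case (Cons m ms)
  thus ?case using assms(1) prime_dvd_fact_iff[of p m] by (auto simp: prime_dvd_mult_iff)
qed (use assms(1) in auto)

text \<open>A prime factor of \<open>d\<close> divides some \<open>m!\<close> and is therefore at most \<open>m\<close>.\<close>

lemma rough_divisor_impossible: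
  assumes eq: "(\<Prod>j=n..n+r. trib j) = (\<Prod>m\<leftarrow>ms. fact m)" and j: "n \<le> j" "j \<le> n + r"
    and d: "rough M d" "d dvd trib j" and M: "\<forall>m\<in>set ms. m \<le> M"
  shows False
proof -
  have "d \<noteq> 1" using d(1) by (simp add: rough_def)
  then obtain p where p: "prime p" "p dvd d" by (metis prime_factor_nat)
  have "trib j dvd (\<Prod>j=n..n+r. trib j)" using j by (intro dvd_prodI) auto
  hence "p dvd (\<Prod>m\<leftarrow>ms. fact m)" unfolding eq using p(2) d(2) dvd_trans by blast
  then obtain m where "m \<in> set ms" "p \<le> m" using prime_dvd_prod_factD[OF p(1)] by blast
  hence "p \<le> M" using M by force
  moreover have "M < p" using d(1) p unfolding rough_def by blast
  ultimately show False by simp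
qed

text \<open>The bound \<open>2 V + 1\<close> with the estimate of \<open>V\<close> inserted.\<close>

lemma factorial_args_le:
  assumes "n > 0" "n + r + 17 < 2 ^ (L + 3)"
    and "(\<Prod>j=n..n+r. trib j) = (\<Prod>m\<leftarrow>ms. fact m)" "m \<in> set ms"
  shows "m \<le> 3 * r + 8 * L + 5"
proof -
  have "m \<le> 2 * (\<Sum>j=n..n+r. multiplicity 2 (trib j)) + 1"
    using prod_fact_bounds(1)[of ms] assms(4)
    unfolding assms(3)[symmetric] multiplicity_2_prod_trib[OF assms(1)] by blast
  thus ?thesis using sum_multiplicity_trib[OF assms(1,2)] by linarith
qed

lemma factorial_args_less_missing_prime:
  assumes "(\<Prod>j=n..n+r. trib j) = (\<Prod>m\<leftarrow>ms. fact m)" "m \<in> set ms" "prime q"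
    "\<forall>j\<in>{n..n+r}. \<not> q dvd trib j"
  shows "m < q"
proof (rule ccontr)
  assume "\<not> m < q"
  hence "q dvd fact m" using assms(3) by (simp add: prime_dvd_fact_iff)
  moreover have "fact m dvd (\<Prod>m\<leftarrow>ms. fact m :: nat)" using assms(2)
    by (induction ms) auto
  ultimately have "q dvd (\<Prod>j=n..n+r. trib j)" unfolding assms(1) by (rule dvd_trans)
  thus False using assms(3,4) by (simp add: prime_dvd_prod_iff)
qed

text \<open>Three devices: a 265-rough divisor for intervals that reach 20, a 77-rough one below 20, and a missing
  prime \<open>q\<close> together with a \<open>(q - 1)\<close>-rough divisor for \<open>T\<^sub>3\<^sub>4 T\<^sub>3\<^sub>5\<close> (\<open>q = 5\<close>), \<open>T\<^sub>1\<^sub>4 T\<^sub>1\<^sub>5\<close> (\<open>q = 3\<close>) and the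
  intervals below 10 (\<open>q = 5\<close>); the only one of these that avoids the indices 5, 6 and 8 consists of
  3 and 4.\<close>

lemma indices_below_80:
  assumes n: "n \<ge> 3" and r: "r \<ge> 1" and small: "n + r < 80"
    and eq: "(\<Prod>j=n..n+r. trib j) = (\<Prod>m\<leftarrow>ms. fact m)"
  shows "n = 3 \<and> r = 1"
proof -
  have below_80: False if j: "n \<le> j" "j \<le> n + r" "j \<in> fst ` set rough_divisors" for j
  proof -
    have "\<forall>m\<in>set ms. m \<le> 265"
    proof
      fix m assume "m \<in> set ms"
      hence "m \<le> 3 * r + 8 * 4 + 5" using n small by (intro factorial_args_le[OF _ _ eq]) auto
      thus "m \<le> 265" using n small by linarith
    qed
    moreover obtain d where "(j, d) \<in> set rough_divisors" using j(3) by force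
    hence "rough 265 d" "d dvd trib j"
      using rough_divisors_dvd rough_divisors_rough by (auto simp: list_all_iff)
    ultimately show False using rough_divisor_impossible[OF eq j(1,2)] by blast
  qed
  have below_20: False if j: "n \<le> j" "j \<le> n + r" "j \<in> fst ` set rough_divisors_small"
    and less: "n + r < 20" for j
  proof -
    have "\<forall>m\<in>set ms. m \<le> 77"
    proof
      fix m assume "m \<in> set ms"
      hence "m \<le> 3 * r + 8 * 3 + 5" using n less by (intro factorial_args_le[OF _ _ eq]) auto
      thus "m \<le> 77" using n less by linarith
    qed
    moreover obtain d where "(j, d) \<in> set rough_divisors_small" using j(3) by force
    hence "rough 77 d" "d dvd trib j"
      using rough_divisors_small_dvd rough_divisors_small_rough by (auto simp: list_all_iff)
    ultimately show False using rough_divisor_impossible[OF eq j(1,2)] by blast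
  qed
  have missing: False if q: "prime q" "\<forall>j\<in>{n..n+r}. \<not> q dvd trib j"
    and j: "n \<le> j" "j \<le> n + r" "rough (q - 1) d" "d dvd trib j" for q j d
  proof -
    have "\<forall>m\<in>set ms. m \<le> q - 1" using factorial_args_less_missing_prime[OF eq _ q] by fastforce
    thus False using rough_divisor_impossible[OF eq j(1,2,3,4)] by blast
  qed
  consider "n = 34" "r = 1" | "n = 34" "r \<ge> 2" | "n \<ge> 20" "n \<noteq> 34" | "n < 20" "n + r \<ge> 20"
    | "n + r < 20" "n = 14" "r = 1" | "n + r < 20" "n = 14" "r \<ge> 2"
    | "n + r < 20" "n > 8" "n \<noteq> 14" | "n \<le> 8" "10 \<le> n + r" "n + r < 20"
    | "n + r < 10"
    using r by linarith
  thus ?thesis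
  proof cases
    case 1
    have "{n..n+r} = {34, 35}" using 1 by auto
    hence "\<forall>j\<in>{n..n+r}. \<not> 5 dvd trib j" by (simp add: trib_evals)
    moreover have "rough (5 - 1) 103" by (rule roughI) (simp_all add: small_primes_def)
    ultimately show ?thesis using missing[of 5 34 103] 1 by (simp add: trib_evals)
  next
    case 2
    thus ?thesis using below_80[of 36] by (simp add: rough_divisors_def)
  next
    case 3
    hence "n \<in> set [20..<79]" using small r by (simp only: set_upt) simp
    hence "n \<in> fst ` set rough_divisors \<or> Suc n \<in> fst ` set rough_divisors"
      using rough_divisors_cover 3(2) by blast
    moreover have "Suc n \<le> n + r" using r by simp
    ultimately show ?thesis using below_80[of n] below_80[of "Suc n"] by force
  next
    case 4
    thus ?thesis using below_80[of 20] by (simp add: rough_divisors_def)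
  next
    case 5
    have "{n..n+r} = {14, 15}" using 5 by auto
    hence "\<forall>j\<in>{n..n+r}. \<not> 3 dvd trib j" by (simp add: trib_evals)
    moreover have "rough (3 - 1) 1705" by (rule roughI) (simp_all add: small_primes_def)
    ultimately show ?thesis using missing[of 3 14 1705] 5 by (simp add: trib_evals)
  next
    case 6
    thus ?thesis using below_20[of 16] by (simp add: rough_divisors_small_def)
  next
    case 7
    hence "n \<in> set [9..<19]" using r by (simp only: set_upt) simp
    hence "n \<in> fst ` set rough_divisors_small \<or> Suc n \<in> fst ` set rough_divisors_small"
      using rough_divisors_small_cover 7(3) by blast
    moreover have "Suc n \<le> n + r" using r by simp
    ultimately show ?thesis using below_20[of n] below_20[of "Suc n"] 7(1) by force
  next
    case 8
    thus ?thesis using below_20[of 10] by (simp add: rough_divisors_small_def)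
  next
    case 9
    have "\<forall>j\<in>set [3..<10]. \<not> 5 dvd trib j" by (simp add: trib_evals)
    hence "\<forall>j\<in>{n..n+r}. \<not> 5 dvd trib j" using n 9 by (simp only: set_upt) auto
    hence no: False if "n \<le> j" "j \<le> n + r" "rough 4 d" "d dvd trib j" for j d
      using missing[of 5 j d] that by simp
    have rough: "rough 4 7" "rough 4 13" "rough 4 11"
      by (rule roughI; simp add: small_primes_def)+
    have "\<not> (n \<le> 5 \<and> 5 \<le> n + r)" "\<not> (n \<le> 6 \<and> 6 \<le> n + r)" "\<not> (n \<le> 8 \<and> 8 \<le> n + r)"
      using no[OF _ _ rough(1), of 5] no[OF _ _ rough(2), of 6] no[OF _ _ rough(3), of 8]
      by (auto simp: trib_evals)
    thus ?thesis using n r 9 by linarith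
  qed
qed

section \<open>The equation\<close>

text \<open>As 3 does not divide 8, all \<open>m\<close> are 1 or 2, and each 2 contributes one factor 2.\<close>

lemma prod_fact_eq_8:
  fixes ms :: "nat list"
  assumes "\<forall>m\<in>set ms. m \<ge> 1" "(\<Prod>m\<leftarrow>ms. fact m) = (8 :: nat)"
  shows "filter (\<lambda>m. m \<noteq> 1) ms = [2, 2, 2]"
proof -
  have "m = 1 \<or> m = 2" if m: "m \<in> set ms" for m
  proof -
    have "fact m dvd (\<Prod>m\<leftarrow>ms. fact m :: nat)" using m by (induction ms) auto
    hence "fact m dvd (8 :: nat)" using assms(2) by simp
    moreover have "\<not> 3 dvd (8 :: nat)" by simp
    ultimately have "\<not> 3 dvd (fact m :: nat)" using dvd_trans by blast
    hence "\<not> 3 \<le> m" using dvd_fact[of 3 m] by auto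
    thus ?thesis using m assms(1) by fastforce
  qed
  hence "\<forall>m\<in>set ms. m = 1 \<or> m = 2" by blast
  hence "filter (\<lambda>m. m \<noteq> 1) ms = replicate (length (filter (\<lambda>m. m \<noteq> 1) ms)) 2
      \<and> (\<Prod>m\<leftarrow>ms. fact m :: nat) = 2 ^ length (filter (\<lambda>m. m \<noteq> 1) ms)"
    by (induction ms) auto
  moreover from this have "(2::nat) ^ length (filter (\<lambda>m. m \<noteq> 1) ms) = 2 ^ 3"
    using assms(2) by simp
  hence "length (filter (\<lambda>m. m \<noteq> 1) ms) = 3" by (subst (asm) power_inject_exp) simp_all
  ultimately show ?thesis by (simp add: numeral_3_eq_3)
qed

theorem theorem2p1:
  "(\<forall>(n::nat) (r::nat) (ms::nat list).
      n \<ge> 3 \<and> r \<ge> 1 \<and> ms \<noteq> [] \<and> sorted ms \<and> (\<forall>m\<in>set ms. m \<ge> 1) \<and>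
      (\<Prod>i=n..n+r. trib i) = (\<Prod>m\<leftarrow>ms. fact m)
      \<longrightarrow> n = 3 \<and> r = 1 \<and> filter (\<lambda>m. m \<noteq> 1) ms = [2, 2, 2])
   \<and> trib 3 * trib 4 = fact 2 * fact 2 * fact 2"
proof (intro conjI allI impI; (elim conjE)?)
  fix n r :: nat and ms :: "nat list"
  assume n: "n \<ge> 3" and r: "r \<ge> 1" and ms: "\<forall>m\<in>set ms. m \<ge> 1"
    and eq: "(\<Prod>i=n..n+r. trib i) = (\<Prod>m\<leftarrow>ms. fact m)"
  have "n + r < 80" using large_index_impossible[OF n r _ eq] not_le by blast
  hence nr: "n = 3 \<and> r = 1" using indices_below_80[OF n r _ eq] by blast
  thus "n = 3" "r = 1" by simp_all
  have "{n..n+r} = {3, 4}" using nr by auto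
  hence "(\<Prod>m\<leftarrow>ms. fact m) = (8 :: nat)" using eq by (simp add: trib_evals)
  thus "filter (\<lambda>m. m \<noteq> 1) ms = [2, 2, 2]" using ms by (intro prod_fact_eq_8)
qed (simp add: trib_evals)

end
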